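(* Let $\mathcal H$ be a real Hilbert space, let $f,g,h$ be proper closed convex functions on $\mathcal H$ with $h$ differentiable and $\nabla h$ $(1/\beta)$-Lipschitz, $\beta>0$. Let $A=\partial f$, $B=\partial g$, $C=\nabla h$, $\gamma\in(0,2\beta)$, $\alpha=2\beta/(4\beta-\gamma)$, and let $T:=I_{\mathcal H}-J_{\gamma B}+J_{\gamma A}\circ(2J_{\gamma B}-I_{\mathcal H}-\gamma C\circ J_{\gamma B})$ have a fixed point $z^\ast$; set $x^\ast=J_{\gamma B}(z^\ast)$. Let $(\lambda_j)_{j\ge0}\subseteq(0,1/\alpha)$ satisfy $\underline\tau=\inf_{j\ge0}\lambda_j(1-\alpha\lambda_j)/\alpha>0$, let $z^0\in\mathcal H$, $z^{k+1}=(1-\lambda_k)z^k+\lambda_kTz^k$, and $x_g^k:=J_{\gamma B}(z^k)$ for $k\ge0$. If $f$ is differentiable and $\nabla f$ is $(1/\beta_f)$-Lipschitz for some $\beta_f>0$, then $$0\le\min_{i=0,\dots,k}\left\{(f+g+h)(x_g^i)-(f+g+h)(x^\ast)\right\}=o\left(\frac1{k+1}\right).$$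
   Context: $J_S:=(I_{\mathcal H}+S)^{-1}$ is the resolvent of a maximal monotone operator $S$; $\partial$ is the convex subdifferential. *)

theory Defs
  imports "HOL-Analysis.Analysis" "HOL-Library.Landau_Symbols"
begin

definition ereal_epigraph :: "('a \<Rightarrow> ereal) \<Rightarrow> ('a \<times> real) set" where
  "ereal_epigraph f = {(x, r). f x \<le> ereal r}"

definition proper_fun :: "('a \<Rightarrow> ereal) \<Rightarrow> bool" where
  "proper_fun f \<longleftrightarrow> (\<forall>x. f x \<noteq> -\<infinity>) \<and> (\<exists>x. f x \<noteq> \<infinity>)"

text \<open>Closedness and convexity of an extended-real-valued function are those of its epigraph.\<close>

definition proper_closed_convex :: "('a::real_normed_vector \<Rightarrow> ereal) \<Rightarrow> bool" where
  "proper_closed_convex f \<longleftrightarrow>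
     proper_fun f \<and> closed (ereal_epigraph f) \<and> convex (ereal_epigraph f)"

text \<open>For proper \<open>f\<close> this is empty wherever \<open>f x = \<infinity>\<close>, since the inequality then fails at any
  \<open>y\<close> with \<open>f y\<close> finite.\<close>

definition subdifferential :: "('a::real_inner \<Rightarrow> ereal) \<Rightarrow> 'a \<Rightarrow> 'a set" where
  "subdifferential f x = {u. \<forall>y. f x + ereal (inner u (y - x)) \<le> f y}"

definition scale_op :: "real \<Rightarrow> ('a \<Rightarrow> 'a set) \<Rightarrow> 'a \<Rightarrow> 'a::real_vector set" where
  "scale_op c S x = (\<lambda>u. c *\<^sub>R u) ` S x"

text \<open>\<open>(I + S)\<^sup>-\<^sup>1\<close> for a set-valued operator \<open>S\<close>. If \<open>S\<close> is maximal monotone on a Hilbert space,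
  exactly one \<open>y\<close> satisfies \<open>x \<in> (I + S) y\<close>, for every \<open>x\<close>.\<close>

definition resolvent :: "('a \<Rightarrow> 'a set) \<Rightarrow> 'a \<Rightarrow> 'a::real_vector" where
  "resolvent S x = (THE y. x \<in> (\<lambda>u. y + u) ` S y)"

text \<open>\<open>f\<close> is finite and Frechet differentiable on the whole space, with gradient \<open>G\<close>.\<close>

definition has_gradient :: "('a::real_inner \<Rightarrow> ereal) \<Rightarrow> ('a \<Rightarrow> 'a) \<Rightarrow> bool" where
  "has_gradient f G \<longleftrightarrow>
     (\<forall>x. \<bar>f x\<bar> \<noteq> \<infinity>) \<and> (\<forall>x. GDERIV (\<lambda>y. real_of_ereal (f y)) x :> G x)"

definition three_op_splitting ::
    "real \<Rightarrow> ('a \<Rightarrow> 'a set) \<Rightarrow> ('a \<Rightarrow> 'a set) \<Rightarrow> ('a \<Rightarrow> 'a) \<Rightarrow> 'a \<Rightarrow> 'a::real_vector" where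
  "three_op_splitting \<gamma> A B C z =
     (let JA = resolvent (scale_op \<gamma> A); JB = resolvent (scale_op \<gamma> B)
      in z - JB z + JA (2 *\<^sub>R JB z - z - \<gamma> *\<^sub>R C (JB z)))"

end

(* Write x_B, x_A for the two resolvent points at z, u_B, u_A for the subgradients they produce, and
   w = z - T z = x_B - x_A = \<gamma> (u_A + u_B + C x_B). The three subgradient inequalities at x_B
   (for f: at x_A, corrected by the descent lemma) bound the objective gap by
   <w, x_B - x*> / \<gamma> + O(|w|^2). The sequence |w|^2 is summable because T is averaged. The products
   <z_k - z_(k+1), x_B - x*> telescope up to |z_k - z_(k+1)|^2: split z = x_B + \<gamma> u_B; the x_B part
   telescopes in |x_B - x*|^2, the u_B part in the Fenchel dual gap of g. So the gaps are summable,
   and running minima of a summable nonnegative sequence are o(1 / (k + 1)). *)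

theory Submission
  imports Defs
begin

subsection \<open>Convex functions and their subgradients\<close>

lemma proper_subdifferential_finite:
  assumes "proper_fun f" "u \<in> subdifferential f x"
  shows "\<bar>f x\<bar> \<noteq> \<infinity>"
proof -
  obtain y where y: "f y \<noteq> \<infinity>" "f y \<noteq> -\<infinity>" "f x \<noteq> -\<infinity>"
    using assms(1) unfolding proper_fun_def by blast
  have "f x + ereal (inner u (y - x)) \<le> f y"
    using assms(2) unfolding subdifferential_def by blast
  then show ?thesis
    using y by (cases "f x"; cases "f y") auto
qed

lemma subgradient_ineq:
  assumes "u \<in> subdifferential f x" "\<bar>f x\<bar> \<noteq> \<infinity>" "\<bar>f y\<bar> \<noteq> \<infinity>"
  shows "inner u (y - x) \<le> real_of_ereal (f y) - real_of_ereal (f x)"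
proof -
  have "f x + ereal (inner u (y - x)) \<le> f y"
    using assms(1) unfolding subdifferential_def by blast
  then show ?thesis
    using assms(2,3) by (cases "f x"; cases "f y") auto
qed

lemma subdifferential_monotone:
  assumes "proper_fun f" "u \<in> subdifferential f x" "v \<in> subdifferential f y"
  shows "inner (u - v) (x - y) \<ge> 0"
proof -
  have fin: "\<bar>f x\<bar> \<noteq> \<infinity>" "\<bar>f y\<bar> \<noteq> \<infinity>"
    by (rule proper_subdifferential_finite[OF assms(1,2)],
        rule proper_subdifferential_finite[OF assms(1,3)])
  have "inner u (y - x) + inner v (x - y) \<le> 0"
    using subgradient_ineq[OF assms(2) fin] subgradient_ineq[OF assms(3) fin(2,1)] by linarith
  then show ?thesis
    by (simp add: inner_diff_left inner_diff_right)
qed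

lemma convex_epigraph_imp_convex_on:
  assumes "convex (ereal_epigraph f)" "\<And>x. \<bar>f x\<bar> \<noteq> \<infinity>"
  shows "convex_on UNIV (\<lambda>x. real_of_ereal (f x))"
proof (rule convex_onI)
  fix t :: real and x y
  assume t: "0 < t" "t < 1"
  have epi: "(v, real_of_ereal (f v)) \<in> ereal_epigraph f" for v
    using assms(2)[of v] by (simp add: ereal_epigraph_def ereal_real')
  have "(1 - t) *\<^sub>R (x, real_of_ereal (f x)) + t *\<^sub>R (y, real_of_ereal (f y)) \<in> ereal_epigraph f"
    using convexD[OF assms(1) epi[of x] epi[of y], of "1 - t" t] t by simp
  then have "f ((1 - t) *\<^sub>R x + t *\<^sub>R y)
      \<le> ereal ((1 - t) * real_of_ereal (f x) + t * real_of_ereal (f y))"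
    by (simp add: ereal_epigraph_def)
  then show "real_of_ereal (f ((1 - t) *\<^sub>R x + t *\<^sub>R y))
      \<le> (1 - t) * real_of_ereal (f x) + t * real_of_ereal (f y)"
    using assms(2)[of "(1 - t) *\<^sub>R x + t *\<^sub>R y"]
    by (cases "f ((1 - t) *\<^sub>R x + t *\<^sub>R y)") auto
qed simp

subsection \<open>Gradients\<close>

text \<open>Reduces statements about gradients to one-variable calculus along a line through
  \<open>x\<close>.\<close>

lemma GDERIV_line:
  fixes \<phi> :: "'a::real_inner \<Rightarrow> real"
  assumes "\<And>x. GDERIV \<phi> x :> G x"
  shows "((\<lambda>t. \<phi> (x + t *\<^sub>R d)) has_real_derivative inner (G (x + t *\<^sub>R d)) d) (at t)"
proof -
  have 1: "(\<phi> has_derivative (\<lambda>v. inner v (G (x + t *\<^sub>R d)))) (at (x + t *\<^sub>R d))"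
    using assms[of "x + t *\<^sub>R d"] by (simp add: gderiv_def)
  have 2: "((\<lambda>t. x + t *\<^sub>R d) has_derivative (\<lambda>s. s *\<^sub>R d)) (at t)"
    by (auto intro!: derivative_eq_intros)
  have "((\<lambda>t. \<phi> (x + t *\<^sub>R d)) has_derivative (\<lambda>s. inner (s *\<^sub>R d) (G (x + t *\<^sub>R d)))) (at t)"
    using has_derivative_compose[OF 2 1] .
  then show ?thesis
    unfolding has_field_derivative_def
    by (rule has_derivative_eq_rhs) (auto simp: inner_commute)
qed

text \<open>Restricted to the line through \<open>x\<close> and \<open>y\<close>, \<phi> is a convex
  function of one real variable and lies above its tangent at 0; the tangent is evaluated at
  1.\<close>

lemma convex_gradient_ineq:
  fixes \<phi> :: "'a::real_inner \<Rightarrow> real"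
  assumes "convex_on UNIV \<phi>" "\<And>x. GDERIV \<phi> x :> G x"
  shows "inner (G x) (y - x) \<le> \<phi> y - \<phi> x"
proof -
  have "convex_on UNIV (\<lambda>t. \<phi> (x + t *\<^sub>R (y - x)))"
  proof (rule convex_onI)
    fix t a b :: real
    assume t: "0 < t" "t < 1"
    have "x + ((1 - t) *\<^sub>R a + t *\<^sub>R b) *\<^sub>R (y - x)
        = (1 - t) *\<^sub>R (x + a *\<^sub>R (y - x)) + t *\<^sub>R (x + b *\<^sub>R (y - x))"
      by (simp add: algebra_simps)
    then show "\<phi> (x + ((1 - t) *\<^sub>R a + t *\<^sub>R b) *\<^sub>R (y - x))
        \<le> (1 - t) * \<phi> (x + a *\<^sub>R (y - x)) + t * \<phi> (x + b *\<^sub>R (y - x))"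
      using convex_onD[OF assms(1), of t "x + a *\<^sub>R (y - x)" "x + b *\<^sub>R (y - x)"] t by simp
  qed simp
  then have "inner (G x) (y - x) * (1 - 0) \<le> \<phi> (x + 1 *\<^sub>R (y - x)) - \<phi> (x + 0 *\<^sub>R (y - x))"
    using GDERIV_line[OF assms(2), of x "y - x" 0]
    by (intro convex_on_imp_above_tangent[where A = UNIV]) auto
  then show ?thesis by simp
qed

text \<open>The descent lemma: the slope along the segment from \<open>x\<close> to \<open>y\<close>
  drifts by at most \<open>L * t * (norm d)\<^sup>2\<close>, and integrating this drift gives the
  quadratic term.\<close>

lemma lipschitz_gradient_descent:
  fixes \<phi> :: "'a::real_inner \<Rightarrow> real"
  assumes "\<And>x. GDERIV \<phi> x :> G x" and lip: "L-lipschitz_on UNIV G"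
  shows "\<phi> y \<le> \<phi> x + inner (G x) (y - x) + L / 2 * (norm (y - x))\<^sup>2"
proof -
  define d where "d = y - x"
  \<comment> \<open>The function on the segment minus its quadratic upper model; comparing the
    endpoints 0 and 1 is the claim, so it suffices that \<psi> does not increase.\<close>
  define \<psi> where "\<psi> t = \<phi> (x + t *\<^sub>R d) - t * inner (G x) d - L / 2 * (norm d)\<^sup>2 * t\<^sup>2" for t
  have "\<psi> 1 \<le> \<psi> 0"
  proof (rule DERIV_nonpos_imp_nonincreasing[of 0 1 \<psi>])
    fix t :: real
    assume t: "0 \<le> t" "t \<le> 1"
    have deriv: "(\<psi> has_real_derivative
        inner (G (x + t *\<^sub>R d)) d - inner (G x) d - L * (norm d)\<^sup>2 * t) (at t)"
      unfolding \<psi>_def by (auto intro!: derivative_eq_intros GDERIV_line[OF assms(1)])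
    have "inner (G (x + t *\<^sub>R d) - G x) d \<le> norm (G (x + t *\<^sub>R d) - G x) * norm d"
      by (rule norm_cauchy_schwarz)
    also have "\<dots> \<le> (L * (t * norm d)) * norm d"
      using lipschitz_onD[OF lip, of "x + t *\<^sub>R d" x] t
      by (intro mult_right_mono) (auto simp: dist_norm)
    finally have "inner (G (x + t *\<^sub>R d)) d - inner (G x) d - L * (norm d)\<^sup>2 * t \<le> 0"
      by (simp add: inner_diff_left power2_eq_square algebra_simps)
    then show "\<exists>y. (\<psi> has_real_derivative y) (at t) \<and> y \<le> 0"
      using deriv by blast
  qed simp
  then show ?thesis by (simp add: \<psi>_def d_def)
qed

text \<open>Compares two bounds on \<phi> at an auxiliary point: the tangent at \<open>x\<close>
  from below and the quadratic model at \<open>y\<close> from above.\<close>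

lemma convex_lipschitz_gradient_ineq:
  fixes \<phi> :: "'a::real_inner \<Rightarrow> real"
  assumes cvx: "convex_on UNIV \<phi>" and grad: "\<And>x. GDERIV \<phi> x :> G x"
    and \<beta>: "\<beta> > 0" and lip: "(1 / \<beta>)-lipschitz_on UNIV G"
  shows "\<phi> x + inner (G x) (y - x) + \<beta> / 2 * (norm (G y - G x))\<^sup>2 \<le> \<phi> y"
proof -
  \<comment> \<open>This point minimizes the quadratic upper model at \<open>y\<close> of \<phi>
    minus the linear form \<open>inner (G x)\<close>, so the comparison gains as much as
    possible.\<close>
  define v where "v = y - \<beta> *\<^sub>R (G y - G x)"
  have 1: "inner (G x) (v - x) \<le> \<phi> v - \<phi> x"
    by (rule convex_gradient_ineq[OF cvx grad])
  have 2: "\<phi> v \<le> \<phi> y + inner (G y) (v - y) + (1 / \<beta>) / 2 * (norm (v - y))\<^sup>2"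
    by (rule lipschitz_gradient_descent[OF grad lip])
  have 3: "(1 / \<beta>) / 2 * (norm (v - y))\<^sup>2 = \<beta> / 2 * (norm (G y - G x))\<^sup>2"
    using \<beta> by (simp add: v_def power2_eq_square)
  have 4: "inner (G y) (v - y) = - \<beta> * inner (G y) (G y - G x)"
    by (simp add: v_def)
  have 5: "inner (G x) (v - x) = inner (G x) (y - x) - \<beta> * inner (G x) (G y - G x)"
    by (simp add: v_def inner_diff_right algebra_simps)
  have 6: "(norm (G y - G x))\<^sup>2 = inner (G y) (G y - G x) - inner (G x) (G y - G x)"
    by (simp add: power2_norm_eq_inner inner_diff_left)
  have "\<beta> * (norm (G y - G x))\<^sup>2
      = \<beta> * inner (G y) (G y - G x) - \<beta> * inner (G x) (G y - G x)"
    by (simp add: 6 right_diff_distrib)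
  then show ?thesis using 1 2 unfolding 3 4 5 by (simp add: field_simps)
qed

text \<open>Cocoercivity of the gradient: add the sharpened tangent inequality to its copy with
  \<open>x\<close> and \<open>y\<close> exchanged, and the function values cancel.\<close>

lemma Baillon_Haddad:
  fixes \<phi> :: "'a::real_inner \<Rightarrow> real"
  assumes "convex_on UNIV \<phi>" "\<And>x. GDERIV \<phi> x :> G x"
    and "\<beta> > 0" "(1 / \<beta>)-lipschitz_on UNIV G"
  shows "\<beta> * (norm (G x - G y))\<^sup>2 \<le> inner (G x - G y) (x - y)"
  using convex_lipschitz_gradient_ineq[OF assms, of x y]
    convex_lipschitz_gradient_ineq[OF assms, of y x]
  by (simp add: inner_diff_left inner_diff_right norm_minus_commute)

text \<open>Subtracting the linear form given by \<open>u\<close> leaves a function minimal at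
  \<open>x\<close>, so all its directional derivatives there vanish.\<close>

lemma subgradient_eq_gradient:
  assumes grad: "has_gradient f G" and u: "u \<in> subdifferential f x"
  shows "u = G x"
proof -
  define \<phi> where "\<phi> y = real_of_ereal (f y)" for y
  have fin: "\<bar>f y\<bar> \<noteq> \<infinity>" and gd: "GDERIV \<phi> y :> G y" for y
    using grad by (auto simp: has_gradient_def \<phi>_def[abs_def])
  \<comment> \<open>In this direction the derivative is \<open>inner d d\<close>, so its vanishing
    forces \<open>d = 0\<close>.\<close>
  define d where "d = G x - u"
  have deriv: "((\<lambda>t. \<phi> (x + t *\<^sub>R d) - t * inner u d) has_real_derivative
      inner (G (x + 0 *\<^sub>R d)) d - inner u d) (at 0)"
    by (auto intro!: derivative_eq_intros GDERIV_line[OF gd])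
  have "inner (G (x + 0 *\<^sub>R d)) d - inner u d = 0"
  proof (rule DERIV_local_min[OF deriv zero_less_one], intro allI impI)
    fix t :: real
    show "\<phi> (x + 0 *\<^sub>R d) - 0 * inner u d \<le> \<phi> (x + t *\<^sub>R d) - t * inner u d"
      using subgradient_ineq[OF u fin fin, of "x + t *\<^sub>R d"] by (simp add: \<phi>_def)
  qed
  then have "inner d d = 0"
    by (simp add: d_def inner_diff_left)
  then show ?thesis by (simp add: d_def)
qed

subsection \<open>Resolvents of subdifferentials\<close>

text \<open>A neighbourhood of \<open>(x0, r1)\<close> misses \<open>E\<close>; shrinking a point of \<open>E\<close> towards \<open>(x0, r0)\<close> into this
  neighbourhood bounds its height from below.\<close>

lemma closed_convex_affine_minorant:
  fixes E :: "('a::real_normed_vector \<times> real) set"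
  assumes cl: "closed E" and cvx: "convex E"
    and in0: "(x0, r0) \<in> E" and out: "(x0, r1) \<notin> E" and up: "\<And>x r s. (x, r) \<in> E \<Longrightarrow> r \<le> s \<Longrightarrow> (x, s) \<in> E"
  shows "\<exists>a b. b \<ge> 0 \<and> (\<forall>(x, r) \<in> E. a - b * norm (x - x0) \<le> r)"
proof -
  have "open (- E)" using cl by (simp add: open_Compl)
  then obtain \<delta> where \<delta>: "\<delta> > 0" "\<And>p. dist p (x0, r1) < \<delta> \<Longrightarrow> p \<in> - E"
    using out unfolding open_dist by (metis ComplI)
  have r01: "r1 < r0" using up[OF in0] out by (meson not_le)
  define b where "b = 2 * (r0 - r1) / \<delta>"
  have "r0 - b * \<delta> - b * norm (x - x0) \<le> r" if xr: "(x, r) \<in> E" for x r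
  proof -
    define D where "D = norm (x - x0)"
    \<comment> \<open>Small enough that the shrunken point stays within horizontal distance \<delta>
      of \<open>x0\<close>; dividing by \<open>t\<close> later turns the height drop
      \<open>r0 - r1\<close> into exactly \<open>b * (D + \<delta>)\<close>, which explains
      \<open>b\<close>.\<close>
    define t where "t = \<delta> / (2 * (D + \<delta>))"
    have D: "D \<ge> 0" by (simp add: D_def)
    have t: "0 < t" "t < 1" "t * D < \<delta>"
      using D \<delta>(1) by (auto simp: t_def field_simps add_nonneg_pos)
    have "(1 - t) *\<^sub>R (x0, r0) + t *\<^sub>R (x, r) \<in> E"
      using convexD[OF cvx in0 xr, of "1 - t" t] t by simp
    then have "(x0 + t *\<^sub>R (x - x0), r0 + t * (r - r0)) \<in> E"
      by (simp add: algebra_simps)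
    \<comment> \<open>At height \<open>r1\<close> the shrunken point lies in the excluded ball; as
      \<open>E\<close> is closed upwards, the height of the point that is in \<open>E\<close> must
      exceed \<open>r1\<close>.\<close>
    moreover have "(x0 + t *\<^sub>R (x - x0), r1) \<notin> E"
      using \<delta>(2)[of "(x0 + t *\<^sub>R (x - x0), r1)"] t
      by (simp add: dist_Pair_Pair dist_norm D_def)
    ultimately have "r1 < r0 + t * (r - r0)"
      using up by (meson not_le)
    then have "(r1 - r0) / t < r - r0"
      using t by (simp add: field_simps)
    moreover have "(r1 - r0) / t = - b * (D + \<delta>)"
      using \<delta>(1) D by (simp add: t_def b_def field_simps)
    ultimately show ?thesis by (simp add: D_def algebra_simps)
  qed
  moreover have "b \<ge> 0" using r01 \<delta>(1) by (simp add: b_def)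
  ultimately show ?thesis by blast
qed

lemma parallelogram_midpoint:
  fixes a b :: "'a::real_inner"
  shows "(norm ((1 / 2) *\<^sub>R (a + b)))\<^sup>2 = (norm a)\<^sup>2 / 2 + (norm b)\<^sup>2 / 2 - (norm (a - b))\<^sup>2 / 4"
  unfolding power2_norm_eq_inner
  by (simp add: inner_add_left inner_add_right inner_diff_left inner_diff_right inner_commute field_simps)

text \<open>The direct method: uniform convexity of the squared norm makes a minimizing sequence
  Cauchy, completeness gives a limit, and closedness keeps it in \<open>E\<close>. Treating the
  height as a separate coordinate allows closedness of the epigraph to be used directly.\<close>

lemma prox_attained:
  fixes E :: "('a::{real_inner, complete_space} \<times> real) set"
  assumes cl: "closed E" and cvx: "convex E" and ne: "E \<noteq> {}"
    and bdd: "\<And>x r. (x, r) \<in> E \<Longrightarrow> M \<le> r + c * (norm (x - z))\<^sup>2" and c: "c > 0"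
  shows "\<exists>(x, r) \<in> E. \<forall>(y, s) \<in> E. r + c * (norm (x - z))\<^sup>2 \<le> s + c * (norm (y - z))\<^sup>2"
proof -
  define q where "q p = snd p + c * (norm (fst p - z))\<^sup>2" for p :: "'a \<times> real"
  define m where "m = Inf (q ` E)"
  have bb: "bdd_below (q ` E)"
    using bdd by (intro bdd_belowI[of _ M]) (auto simp: q_def)
  have m: "m \<le> q p" if "p \<in> E" for p
    unfolding m_def using that bb by (intro cInf_lower) auto
  have "\<exists>p \<in> E. q p < m + inverse (real (Suc n))" for n
    using cInf_lessD[of "q ` E" "m + inverse (real (Suc n))"] ne by (auto simp: m_def)
  then obtain p where p: "\<And>n. p n \<in> E" "\<And>n. q (p n) < m + inverse (real (Suc n))"
    by metis
  define x where "x n = fst (p n)" for n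
  define r where "r n = snd (p n)" for n
  \<comment> \<open>The midpoint of two nearly optimal points has value at least \<open>m\<close>,
    yet it beats their average by a multiple of their squared distance, so that distance is
    small.\<close>
  have key: "c / 4 * (norm (x i - x j))\<^sup>2 \<le> inverse (real (Suc i)) / 2 + inverse (real (Suc j)) / 2" for i j
  proof -
    have "(1 / 2) *\<^sub>R p i + (1 / 2) *\<^sub>R p j \<in> E"
      using convexD[OF cvx p(1) p(1), of "1 / 2" "1 / 2"] by simp
    from m[OF this]
    have *: "m \<le> r i / 2 + r j / 2 + c * (norm ((1 / 2) *\<^sub>R x i + (1 / 2) *\<^sub>R x j - z))\<^sup>2"
      by (simp add: q_def x_def r_def)
    have "(1 / 2) *\<^sub>R x i + (1 / 2) *\<^sub>R x j - z = (1 / 2) *\<^sub>R ((x i - z) + (x j - z))"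
      by (simp add: algebra_simps flip: scaleR_add_left)
    then have "(norm ((1 / 2) *\<^sub>R x i + (1 / 2) *\<^sub>R x j - z))\<^sup>2
        = (norm (x i - z))\<^sup>2 / 2 + (norm (x j - z))\<^sup>2 / 2 - (norm (x i - x j))\<^sup>2 / 4"
      by (simp only: parallelogram_midpoint) simp
    then have "c * (norm ((1 / 2) *\<^sub>R x i + (1 / 2) *\<^sub>R x j - z))\<^sup>2
        = c * (norm (x i - z))\<^sup>2 / 2 + c * (norm (x j - z))\<^sup>2 / 2 - c / 4 * (norm (x i - x j))\<^sup>2"
      by (simp only:) (simp add: algebra_simps)
    then have "m \<le> q (p i) / 2 + q (p j) / 2 - c / 4 * (norm (x i - x j))\<^sup>2"
      unfolding q_def x_def[symmetric] r_def[symmetric] using * by (simp add: add_divide_distrib)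
    then show ?thesis using p(2)[of i] p(2)[of j] by linarith
  qed
  have "Cauchy x"
  proof (rule metric_CauchyI)
    fix e :: real
    assume e: "e > 0"
    then obtain N where N: "inverse (real (Suc N)) < c / 4 * e\<^sup>2"
      using c reals_Archimedean[of "c / 4 * e\<^sup>2"] by auto
    have "dist (x i) (x j) < e" if ij: "i \<ge> N" "j \<ge> N" for i j
    proof -
      have "inverse (real (Suc i)) \<le> inverse (real (Suc N))"
        "inverse (real (Suc j)) \<le> inverse (real (Suc N))"
        using ij by (auto intro!: le_imp_inverse_le)
      then have "c / 4 * (norm (x i - x j))\<^sup>2 < c / 4 * e\<^sup>2"
        using key[of i j] N by linarith
      then have "(norm (x i - x j))\<^sup>2 < e\<^sup>2" using c by simp
      then show ?thesis using e by (simp add: dist_norm power2_less_imp_less)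
    qed
    then show "\<exists>N. \<forall>i\<ge>N. \<forall>j\<ge>N. dist (x i) (x j) < e" by blast
  qed
  then obtain y where y: "x \<longlonglongrightarrow> y"
    using Cauchy_convergent convergent_def by blast
  have "(\<lambda>n. m + inverse (real (Suc n))) \<longlonglongrightarrow> m + 0"
    by (intro tendsto_add tendsto_const LIMSEQ_inverse_real_of_nat)
  then have ub: "(\<lambda>n. m + inverse (real (Suc n))) \<longlonglongrightarrow> m" by simp
  have q: "(\<lambda>n. q (p n)) \<longlonglongrightarrow> m"
  proof (rule tendsto_sandwich[OF _ _ tendsto_const ub])
    show "\<forall>\<^sub>F n in sequentially. m \<le> q (p n)"
      by (intro always_eventually allI m p)
    show "\<forall>\<^sub>F n in sequentially. q (p n) \<le> m + inverse (real (Suc n))"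
      by (intro always_eventually allI less_imp_le p)
  qed
  \<comment> \<open>The only possible limit of the heights, since the values tend to
    \<open>m\<close> and the base points to \<open>y\<close>.\<close>
  define s where "s = m - c * (norm (y - z))\<^sup>2"
  have "(\<lambda>n. q (p n) - c * (norm (x n - z))\<^sup>2) \<longlonglongrightarrow> s"
    unfolding s_def by (intro tendsto_intros q y)
  then have "(\<lambda>n. snd (p n)) \<longlonglongrightarrow> s" by (simp add: q_def x_def)
  then have "(\<lambda>n. (fst (p n), snd (p n))) \<longlonglongrightarrow> (y, s)"
    using y unfolding x_def by (intro tendsto_Pair)
  then have "(y, s) \<in> E"
    using closed_sequentially[OF cl, of p] p(1) by simp
  moreover have "s + c * (norm (y - z))\<^sup>2 \<le> s' + c * (norm (y' - z))\<^sup>2" if "(y', s') \<in> E" for y' s'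
    using m[OF that] by (simp add: s_def q_def)
  ultimately show ?thesis by blast
qed

text \<open>Surjectivity of the identity plus \<gamma> times the subdifferential: the inclusion is
  the optimality condition for minimizing \<open>r + (norm (x - z))\<^sup>2 / (2 * \<gamma>)\<close>
  over the epigraph.\<close>

lemma prox_exists:
  fixes g :: "'a::{real_inner, complete_space} \<Rightarrow> ereal"
  assumes g: "proper_closed_convex g" and \<gamma>: "\<gamma> > 0"
  shows "\<exists>x. (1 / \<gamma>) *\<^sub>R (z - x) \<in> subdifferential g x"
proof -
  define E where "E = ereal_epigraph g"
  have cl: "closed E" and cvx: "convex E" and pr: "proper_fun g"
    using g by (auto simp: proper_closed_convex_def E_def)
  have E: "(x, r) \<in> E \<longleftrightarrow> g x \<le> ereal r" for x r
    by (simp add: E_def ereal_epigraph_def)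
  obtain x0 where "\<bar>g x0\<bar> \<noteq> \<infinity>" using pr by (auto simp: proper_fun_def)
  then obtain r0 where r0: "g x0 = ereal r0" by (cases "g x0") auto
  have up: "(x, s) \<in> E" if "(x, r) \<in> E" "r \<le> s" for x r s
    using that order_trans[of "g x" "ereal r" "ereal s"] by (simp add: E)
  have r0_mem: "(x0, r0) \<in> E" "(x0, r0 - 1) \<notin> E" using r0 by (simp_all add: E)
  have "\<exists>a b. b \<ge> 0 \<and> (\<forall>(x, r) \<in> E. a - b * norm (x - x0) \<le> r)"
    by (rule closed_convex_affine_minorant[OF cl cvx r0_mem]) (rule up)
  then obtain a b where ab: "b \<ge> 0" "\<And>x r. (x, r) \<in> E \<Longrightarrow> a - b * norm (x - x0) \<le> r"
    by blast
  define c where "c = 1 / (2 * \<gamma>)"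
  have c: "c > 0" using \<gamma> by (simp add: c_def)
  have "a - b * norm (z - x0) - b\<^sup>2 / (4 * c) \<le> r + c * (norm (x - z))\<^sup>2" if "(x, r) \<in> E" for x r
  proof -
    have "norm (x - x0) \<le> norm (x - z) + norm (z - x0)"
      using norm_triangle_ineq[of "x - z" "z - x0"] by simp
    then have "b * norm (x - x0) \<le> b * norm (x - z) + b * norm (z - x0)"
      using ab(1) by (metis mult_left_mono distrib_left)
    \<comment> \<open>Completing the square: the quadratic absorbs the linear decrease allowed by
      the minorant, so the objective is bounded below.\<close>
    moreover have "b * norm (x - z) \<le> b\<^sup>2 / (4 * c) + c * (norm (x - z))\<^sup>2"
    proof -
      have "0 \<le> (b - 2 * c * norm (x - z))\<^sup>2 / (4 * c)" using c by simp
      also have "\<dots> = b\<^sup>2 / (4 * c) + c * (norm (x - z))\<^sup>2 - b * norm (x - z)"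
        using c by (simp add: power2_eq_square field_simps)
      finally show ?thesis by simp
    qed
    ultimately show ?thesis using ab(2)[OF that] by linarith
  qed
  moreover have "E \<noteq> {}" using r0 E by (metis empty_iff order_refl)
  ultimately obtain x r where xr: "(x, r) \<in> E"
    and min: "\<And>y s. (y, s) \<in> E \<Longrightarrow> r + c * (norm (x - z))\<^sup>2 \<le> s + c * (norm (y - z))\<^sup>2"
    using prox_attained[OF cl cvx, of _ c z] c by blast
  have sub: "inner ((1 / \<gamma>) *\<^sub>R (z - x)) (y - x) \<le> s - r" if ys: "(y, s) \<in> E" for y s
  proof -
    \<comment> \<open>First variation: move from the minimizer a fraction \<open>t\<close> of the
      way to \<open>(y, s)\<close>, expand the square and divide by \<open>t\<close>. Letting
      \<open>t\<close> tend to 0 from the right then removes the quadratic remainder.\<close>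
    have "0 \<le> (s - r) - inner ((1 / \<gamma>) *\<^sub>R (z - x)) (y - x) + t * (c * (norm (y - x))\<^sup>2)"
      if t: "0 < t" "t < 1" for t :: real
    proof -
      have "(1 - t) *\<^sub>R (x, r) + t *\<^sub>R (y, s) \<in> E"
        using convexD[OF cvx xr ys, of "1 - t" t] t by simp
      then have "(x + t *\<^sub>R (y - x), r + t * (s - r)) \<in> E"
        by (simp add: algebra_simps)
      from min[OF this]
      have "c * (norm (x - z))\<^sup>2 \<le> t * (s - r) + c * (norm ((x - z) + t *\<^sub>R (y - x)))\<^sup>2"
        by (simp add: algebra_simps)
      also have "(norm ((x - z) + t *\<^sub>R (y - x)))\<^sup>2
          = (norm (x - z))\<^sup>2 - 2 * t * inner (z - x) (y - x) + t\<^sup>2 * (norm (y - x))\<^sup>2"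
        unfolding power2_norm_eq_inner
        by (simp add: inner_add_left inner_add_right inner_diff_left inner_diff_right
            inner_commute power2_eq_square algebra_simps)
      finally have "0 \<le> t * ((s - r) - 2 * c * inner (z - x) (y - x) + t * (c * (norm (y - x))\<^sup>2))"
        by (simp add: algebra_simps power2_eq_square)
      moreover have "2 * c * inner (z - x) (y - x) = inner ((1 / \<gamma>) *\<^sub>R (z - x)) (y - x)"
        by (simp add: c_def)
      ultimately show ?thesis using t by (simp add: zero_le_mult_iff)
    qed
    then have "eventually (\<lambda>t. 0 \<le> (s - r) - inner ((1 / \<gamma>) *\<^sub>R (z - x)) (y - x)
        + t * (c * (norm (y - x))\<^sup>2)) (at_right (0::real))"
      using eventually_at_right_real[of 0 1] by (auto elim: eventually_mono)
    moreover have "((\<lambda>t. (s - r) - inner ((1 / \<gamma>) *\<^sub>R (z - x)) (y - x) + t * (c * (norm (y - x))\<^sup>2))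
        \<longlongrightarrow> (s - r) - inner ((1 / \<gamma>) *\<^sub>R (z - x)) (y - x) + 0 * (c * (norm (y - x))\<^sup>2)) (at_right (0::real))"
      by (intro tendsto_intros)
    ultimately have "0 \<le> (s - r) - inner ((1 / \<gamma>) *\<^sub>R (z - x)) (y - x) + 0 * (c * (norm (y - x))\<^sup>2)"
      using tendsto_lowerbound[OF _ _ trivial_limit_at_right_real] by blast
    then show ?thesis by simp
  qed
  have "g x + ereal (inner ((1 / \<gamma>) *\<^sub>R (z - x)) (y - x)) \<le> g y" for y
  proof (cases "g y")
    case (real s)
    then have "r + inner ((1 / \<gamma>) *\<^sub>R (z - x)) (y - x) \<le> s" using sub[of y s] by (simp add: E)
    moreover have "g x \<le> ereal r" using xr by (simp add: E)
    ultimately show ?thesis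
      using real by (cases "g x") auto
  qed (use pr in \<open>auto simp: proper_fun_def\<close>)
  then show ?thesis by (auto simp: subdifferential_def)
qed

text \<open>The definite description in \<open>resolvent\<close> is well defined: existence is
  \<open>prox_exists\<close>, uniqueness follows from monotonicity. This makes the resolvent usable
  through its subgradient alone.\<close>

lemma resolvent_subgradient:
  fixes g :: "'a::{real_inner, complete_space} \<Rightarrow> ereal"
  assumes g: "proper_closed_convex g" and \<gamma>: "\<gamma> > 0"
  shows "(1 / \<gamma>) *\<^sub>R (z - resolvent (scale_op \<gamma> (subdifferential g)) z)
    \<in> subdifferential g (resolvent (scale_op \<gamma> (subdifferential g)) z)"
proof -
  have pr: "proper_fun g" using g by (simp add: proper_closed_convex_def)
  have iff: "z \<in> (\<lambda>u. y + u) ` scale_op \<gamma> (subdifferential g) y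
      \<longleftrightarrow> (1 / \<gamma>) *\<^sub>R (z - y) \<in> subdifferential g y" for y
  proof
    assume "z \<in> (\<lambda>u. y + u) ` scale_op \<gamma> (subdifferential g) y"
    then obtain u where "u \<in> subdifferential g y" "z = y + \<gamma> *\<^sub>R u"
      by (auto simp: scale_op_def)
    then show "(1 / \<gamma>) *\<^sub>R (z - y) \<in> subdifferential g y" using \<gamma> by simp
  next
    assume *: "(1 / \<gamma>) *\<^sub>R (z - y) \<in> subdifferential g y"
    have "z = y + \<gamma> *\<^sub>R ((1 / \<gamma>) *\<^sub>R (z - y))" using \<gamma> by simp
    then show "z \<in> (\<lambda>u. y + u) ` scale_op \<gamma> (subdifferential g) y"
      using * unfolding scale_op_def by blast
  qed
  have uniq: "x = y" if "(1 / \<gamma>) *\<^sub>R (z - x) \<in> subdifferential g x"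
    "(1 / \<gamma>) *\<^sub>R (z - y) \<in> subdifferential g y" for x y
  proof -
    have "0 \<le> inner ((1 / \<gamma>) *\<^sub>R (z - x) - (1 / \<gamma>) *\<^sub>R (z - y)) (x - y)"
      by (rule subdifferential_monotone[OF pr that])
    also have "(1 / \<gamma>) *\<^sub>R (z - x) - (1 / \<gamma>) *\<^sub>R (z - y) = - ((1 / \<gamma>) *\<^sub>R (x - y))"
      by (simp add: algebra_simps)
    finally have "inner (x - y) (x - y) \<le> 0"
      using \<gamma> by (simp add: divide_le_0_iff)
    then show ?thesis by (metis inner_eq_zero_iff inner_ge_zero order_antisym right_minus_eq)
  qed
  obtain x where x: "(1 / \<gamma>) *\<^sub>R (z - x) \<in> subdifferential g x"
    using prox_exists[OF g \<gamma>] by blast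
  have "resolvent (scale_op \<gamma> (subdifferential g)) z = x"
    unfolding resolvent_def iff by (rule the_equality, rule x, rule uniq[OF _ x])
  then show ?thesis using x by simp
qed

subsection \<open>Sequences\<close>

text \<open>\<open>V\<close> is a Lyapunov function and \<open>s\<close> a summable error, so every
  partial sum of \<open>d\<close> is at most \<open>V 0 + suminf s\<close>.\<close>

lemma summable_of_telescoping:
  fixes d V s :: "nat \<Rightarrow> real"
  assumes d: "\<And>k. 0 \<le> d k" and le: "\<And>k. d k \<le> V k - V (Suc k) + s k"
    and V: "\<And>k. 0 \<le> V k" and s: "\<And>k. 0 \<le> s k" "summable s"
  shows "summable d"
proof (rule summableI_nonneg_bounded[OF d])
  fix n
  have "(\<Sum>i<n. d i) \<le> (\<Sum>i<n. V i - V (Suc i)) + (\<Sum>i<n. s i)"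
    unfolding sum.distrib[symmetric] by (intro sum_mono le)
  also have "(\<Sum>i<n. V i - V (Suc i)) = V 0 - V n"
    by (rule sum_lessThan_telescope')
  also have "\<dots> \<le> V 0" using V[of n] by simp
  also have "(\<Sum>i<n. s i) \<le> suminf s"
    by (rule sum_le_suminf) (auto simp: s)
  finally show "(\<Sum>i<n. d i) \<le> V 0 + suminf s" by simp
qed

text \<open>The minimum up to \<open>k\<close> is at most the average over the indices from
  \<open>N\<close> to \<open>k\<close>, whose sum is an arbitrarily small tail.\<close>

lemma running_Min_smallo:
  fixes d :: "nat \<Rightarrow> real"
  assumes d: "\<And>k. 0 \<le> d k" and sd: "summable d"
  shows "(\<lambda>k. Min (d ` {0..k})) \<in> o(\<lambda>k. 1 / (real k + 1))"
proof (rule landau_o.smallI)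
  fix c :: real
  assume c: "c > 0"
  define m where "m k = Min (d ` {0..k})" for k
  have m0: "0 \<le> m k" for k by (auto simp: m_def d)
  obtain N where N: "\<And>j n. N \<le> j \<Longrightarrow> norm (sum d {j..<n}) < c / 2"
    using summable_Cauchy[of d] sd c by (metis half_gt_zero)
  \<comment> \<open>For \<open>k \<ge> 2 * N\<close> at least half of the \<open>k + 1\<close>
    indices lie in the tail; this factor 2 is why the tail was made smaller than
    \<open>c / 2\<close>.\<close>
  have "m k \<le> c * (1 / (real k + 1))" if k: "k \<ge> 2 * N" for k
  proof -
    have "real (card {N..<Suc k}) * m k \<le> sum d {N..<Suc k}"
      by (intro sum_bounded_below) (auto simp: m_def)
    also have "\<dots> < c / 2" using N[of N "Suc k"] by simp
    finally have "(real k + 1 - real N) * m k < c / 2"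
      using k by (simp add: of_nat_diff algebra_simps)
    moreover have "(real k + 1) / 2 * m k \<le> (real k + 1 - real N) * m k"
      using k m0 by (intro mult_right_mono) auto
    ultimately show ?thesis by (simp add: field_simps)
  qed
  then show "\<forall>\<^sub>F k in at_top. norm (Min (d ` {0..k})) \<le> c * norm (1 / (real k + 1))"
    unfolding eventually_at_top_linorder
    by (intro exI[of _ "2 * N"]) (use m0 in \<open>auto simp: m_def\<close>)
qed

subsection \<open>Three-operator splitting\<close>

text \<open>The vectors \<open>p\<close>, \<open>q\<close>, \<open>r\<close>, \<open>a\<close>, \<open>b\<close> stand for the deviations from the fixed point of
  \<open>u\<^sub>A\<close>, \<open>u\<^sub>B\<close>, \<open>C x\<^sub>B\<close>, \<open>x\<^sub>A\<close>, \<open>x\<^sub>B\<close>.\<close>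

lemma splitting_residual_bound:
  fixes p q r a b :: "'a::real_inner"
  assumes \<gamma>: "\<gamma> > 0" and \<beta>: "\<beta> > 0" and w: "b - a = \<gamma> *\<^sub>R (p + q + r)"
    and p: "0 \<le> inner p a" and q: "0 \<le> inner q b" and r: "\<beta> * (norm r)\<^sup>2 \<le> inner r b"
  shows "(4 * \<beta> - \<gamma>) / (4 * \<beta>) * (norm (b - a))\<^sup>2 \<le> inner (b - a) (b + \<gamma> *\<^sub>R q)"
proof -
  define v where "v = b - a"
  have v: "inner v y = \<gamma> * inner p y + \<gamma> * inner q y + \<gamma> * inner r y" for y
    unfolding v_def w by (simp add: inner_add_left distrib_left)
  have ww: "(norm v)\<^sup>2 = \<gamma> * inner p v + \<gamma> * inner q v + \<gamma> * inner r v"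
    using v[of v] by (simp add: power2_norm_eq_inner)
  \<comment> \<open>Monotonicity for \<open>p\<close> is available at \<open>a\<close> but the bound
    is wanted at \<open>b\<close>; the difference \<open>inner p v\<close> is later absorbed through
    \<open>ww\<close>.\<close>
  have pb: "inner p b = inner p a + inner p v"
    by (simp add: v_def inner_diff_right)
  have "inner v b = \<gamma> * (inner p b + inner q b + inner r b)"
    by (simp add: v[of b] distrib_left)
  moreover have "\<gamma> * (inner p v + \<beta> * (norm r)\<^sup>2) \<le> \<gamma> * (inner p b + inner q b + inner r b)"
    using p q r pb \<gamma> by (intro mult_left_mono) auto
  ultimately have 1: "\<gamma> * inner p v + \<gamma> * \<beta> * (norm r)\<^sup>2 \<le> inner v b"
    by (simp add: distrib_left)
  have "\<gamma> * inner r v \<le> \<gamma> * (norm r * norm v)"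
    using \<gamma> norm_cauchy_schwarz[of r v] by (intro mult_left_mono) auto
  \<comment> \<open>Young's inequality weighted to spend exactly the cocoercivity term; what remains
    is the loss \<gamma> / (4 * \<beta>) in the final constant.\<close>
  moreover have "\<gamma> * (norm r * norm v) \<le> \<gamma> * \<beta> * (norm r)\<^sup>2 + \<gamma> / (4 * \<beta>) * (norm v)\<^sup>2"
  proof -
    have "0 \<le> \<gamma> / (4 * \<beta>) * (2 * \<beta> * norm r - norm v)\<^sup>2" using \<gamma> \<beta> by simp
    also have "\<dots> = \<gamma> * \<beta> * (norm r)\<^sup>2 + \<gamma> / (4 * \<beta>) * (norm v)\<^sup>2 - \<gamma> * (norm r * norm v)"
      using \<beta> by (simp add: power2_eq_square field_simps)
    finally show ?thesis by simp
  qed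
  moreover have "(4 * \<beta> - \<gamma>) / (4 * \<beta>) * (norm v)\<^sup>2 = (norm v)\<^sup>2 - \<gamma> / (4 * \<beta>) * (norm v)\<^sup>2"
    using \<beta> by (simp add: field_simps)
  ultimately show ?thesis
    using 1 ww unfolding v_def[symmetric] by (simp add: inner_add_right inner_commute)
qed

text \<open>The second term of the potential is, up to the constant \<open>g s\<close>, the Fenchel dual gap
  \<open>g\<^sup>* u - \<langle>u, s\<rangle>\<close>, since \<open>g\<^sup>* u = \<langle>u, x\<rangle> - g x\<close> for \<open>u \<in> \<partial>g x\<close>.\<close>

lemma resolvent_potential_step:
  fixes x u x' u' s :: "'a::real_inner" and G G' \<gamma> :: real
  assumes \<gamma>: "\<gamma> > 0" and sub: "inner u (x' - x) \<le> G' - G"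
  shows "inner ((x + \<gamma> *\<^sub>R u) - (x' + \<gamma> *\<^sub>R u')) (x - s)
    \<le> ((norm (x - s))\<^sup>2 / 2 + \<gamma> * (inner u (x - s) - G))
      - ((norm (x' - s))\<^sup>2 / 2 + \<gamma> * (inner u' (x' - s) - G'))
      + (norm ((x + \<gamma> *\<^sub>R u) - (x' + \<gamma> *\<^sub>R u')))\<^sup>2 / 2"
proof -
  have dz: "(x + \<gamma> *\<^sub>R u) - (x' + \<gamma> *\<^sub>R u') = (x - x') + \<gamma> *\<^sub>R (u - u')"
    by (simp add: algebra_simps)
  have 1: "inner (x - x') (x - s) = (norm (x - s))\<^sup>2 / 2 - (norm (x' - s))\<^sup>2 / 2 + (norm (x - x'))\<^sup>2 / 2"
    unfolding power2_norm_eq_inner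
    by (simp add: inner_diff_left inner_diff_right inner_commute field_simps)
  have "inner (u - u') (x - s)
      = inner u (x - s) - inner u' (x' - s) + inner u (x' - x) + inner (x - x') (u - u')"
    by (simp add: inner_diff_left inner_diff_right inner_commute)
  then have "inner (u - u') (x - s)
      \<le> (inner u (x - s) - G) - (inner u' (x' - s) - G') + inner (x - x') (u - u')"
    using sub by linarith
  then have 2: "\<gamma> * inner (u - u') (x - s)
      \<le> \<gamma> * (inner u (x - s) - G) - \<gamma> * (inner u' (x' - s) - G') + \<gamma> * inner (x - x') (u - u')"
    using \<gamma> by (simp flip: right_diff_distrib distrib_left)
  have "(norm ((x - x') + \<gamma> *\<^sub>R (u - u')))\<^sup>2
      = (norm (x - x'))\<^sup>2 + 2 * (\<gamma> * inner (x - x') (u - u')) + (\<gamma> * norm (u - u'))\<^sup>2"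
    using \<gamma> by (simp add: power2_norm_eq_inner inner_add_left inner_add_right inner_commute
        power_mult_distrib) (simp add: power2_eq_square)
  \<comment> \<open>Dropping the square of \<gamma> \<open>* norm (u - u')\<close> bounds the cross
    term, and the released \<open>(norm (x - x'))\<^sup>2 / 2\<close> cancels the surplus in fact
    \<open>1\<close>.\<close>
  then have 3: "\<gamma> * inner (x - x') (u - u')
      \<le> (norm ((x - x') + \<gamma> *\<^sub>R (u - u')))\<^sup>2 / 2 - (norm (x - x'))\<^sup>2 / 2"
    using zero_le_power2[of "\<gamma> * norm (u - u')"] by linarith
  have "inner ((x - x') + \<gamma> *\<^sub>R (u - u')) (x - s)
      = inner (x - x') (x - s) + \<gamma> * inner (u - u') (x - s)"
    by (simp add: inner_add_left)
  then show ?thesis using 1 2 3 unfolding dz by linarith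
qed

theorem theoremD5:
  fixes f g h :: "'a::{real_inner, complete_space} \<Rightarrow> ereal"
    and A B :: "'a \<Rightarrow> 'a set"
    and C T :: "'a \<Rightarrow> 'a"
    and \<beta> \<gamma> \<alpha> :: real
    and zstar xstar :: 'a
    and lam :: "nat \<Rightarrow> real"
    and z xg :: "nat \<Rightarrow> 'a"
  assumes f: "proper_closed_convex f"
    and g: "proper_closed_convex g"
    and h: "proper_closed_convex h"
    and \<beta>: "\<beta> > 0"
    and h_diff: "has_gradient h C"
    and h_lip: "(1 / \<beta>)-lipschitz_on UNIV C"
    and A: "A = subdifferential f"
    and B: "B = subdifferential g"
    and \<gamma>: "0 < \<gamma>" "\<gamma> < 2 * \<beta>"
    and \<alpha>: "\<alpha> = 2 * \<beta> / (4 * \<beta> - \<gamma>)"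
    and T: "T = three_op_splitting \<gamma> A B C"
    and zstar: "T zstar = zstar"
    and xstar: "xstar = resolvent (scale_op \<gamma> B) zstar"
    and lam: "\<And>j. 0 < lam j \<and> lam j < 1 / \<alpha>"
    and tau: "(INF j. lam j * (1 - \<alpha> * lam j) / \<alpha>) > 0"
    and z: "\<And>k. z (Suc k) = (1 - lam k) *\<^sub>R z k + lam k *\<^sub>R T (z k)"
    and xg: "\<And>k. xg k = resolvent (scale_op \<gamma> B) (z k)"
    and f_smooth: "\<exists>\<beta>f > 0. \<exists>F. has_gradient f F \<and> (1 / \<beta>f)-lipschitz_on UNIV F"
  shows "\<exists>r :: nat \<Rightarrow> real.
           (\<forall>k. (MIN i\<in>{0..k}. (f (xg i) + g (xg i) + h (xg i))
                               - (f xstar + g xstar + h xstar)) = ereal (r k))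
         \<and> (\<forall>k. 0 \<le> r k)
         \<and> r \<in> o(\<lambda>k. 1 / (real k + 1))"
proof -

  \<comment> \<open>Resolvent points, their subgradients and the optimality of
    \<open>xstar\<close>\<close>
  have pf: "proper_fun f" and pg: "proper_fun g"
    using f g by (auto simp: proper_closed_convex_def)
  have \<alpha>0: "\<alpha> > 0" and \<alpha>_eq: "(4 * \<beta> - \<gamma>) / (4 * \<beta>) = 1 / (2 * \<alpha>)"
    using \<beta> \<gamma> by (auto simp: \<alpha> field_simps)
  obtain \<beta>f F where \<beta>f: "\<beta>f > 0" and F: "has_gradient f F" and F_lip: "(1 / \<beta>f)-lipschitz_on UNIV F"
    using f_smooth by blast
  define \<phi> where "\<phi> = (\<lambda>x. real_of_ereal (f x))"
  define \<psi> where "\<psi> = (\<lambda>x. real_of_ereal (g x))"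
  define \<eta> where "\<eta> = (\<lambda>x. real_of_ereal (h x))"
  have fin_f: "\<bar>f x\<bar> \<noteq> \<infinity>" and grad_f: "GDERIV \<phi> x :> F x" for x
    using F by (auto simp: has_gradient_def \<phi>_def)
  have fin_h: "\<bar>h x\<bar> \<noteq> \<infinity>" and grad_h: "GDERIV \<eta> x :> C x" for x
    using h_diff by (auto simp: has_gradient_def \<eta>_def)
  have cvx_h: "convex_on UNIV \<eta>"
    unfolding \<eta>_def using h fin_h
    by (intro convex_epigraph_imp_convex_on) (auto simp: proper_closed_convex_def)
  define xB where "xB v = resolvent (scale_op \<gamma> B) v" for v
  define xA where "xA v = resolvent (scale_op \<gamma> A) (2 *\<^sub>R xB v - v - \<gamma> *\<^sub>R C (xB v))" for v
  define uB where "uB v = (1 / \<gamma>) *\<^sub>R (v - xB v)" for v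
  define uA where "uA v = (1 / \<gamma>) *\<^sub>R (2 *\<^sub>R xB v - v - \<gamma> *\<^sub>R C (xB v) - xA v)" for v
  have uB: "uB v \<in> subdifferential g (xB v)" for v
    unfolding uB_def xB_def B by (rule resolvent_subgradient[OF g \<gamma>(1)])
  have uA: "uA v \<in> subdifferential f (xA v)" for v
    unfolding uA_def xA_def A by (rule resolvent_subgradient[OF f \<gamma>(1)])
  have uA_F: "uA v = F (xA v)" for v
    by (rule subgradient_eq_gradient[OF F uA])
  have fin_g: "\<bar>g (xB v)\<bar> \<noteq> \<infinity>" for v
    by (rule proper_subdifferential_finite[OF pg uB])
  have T_eq: "T v = v - xB v + xA v" for v
    by (simp add: T three_op_splitting_def Let_def xA_def xB_def)
  have xB_uB: "xB v + \<gamma> *\<^sub>R uB v = v" for v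
    using \<gamma> by (simp add: uB_def)
  have res: "xB v - xA v = \<gamma> *\<^sub>R (uA v + uB v + C (xB v))" for v
    using \<gamma> by (simp add: uA_def uB_def scaleR_add_right scaleR_2)
  have xs: "xB zstar = xstar" by (simp add: xB_def xstar)
  \<comment> \<open>At a fixed point both resolvent points coincide, so the residual vanishes and
    the three subgradients there sum to zero.\<close>
  have xAs: "xA zstar = xstar" using zstar xs by (simp add: T_eq)
  have opt: "uA zstar + uB zstar + C xstar = 0"
    using res[of zstar] xs xAs \<gamma> by simp
  have sub_g: "inner (uB v) (xB v' - xB v) \<le> \<psi> (xB v') - \<psi> (xB v)" for v v'
    unfolding \<psi>_def by (rule subgradient_ineq[OF uB fin_g fin_g])
  have sub_f: "inner (uA v) (y - xA v) \<le> \<phi> y - \<phi> (xA v)" for v y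
    unfolding \<phi>_def by (rule subgradient_ineq[OF uA fin_f fin_f])
  have sub_h: "inner (C x) (y - x) \<le> \<eta> y - \<eta> x" for x y
    by (rule convex_gradient_ineq[OF cvx_h grad_h])

  \<comment> \<open>Lower and upper bounds for the objective gap\<close>
  define gap where "gap v = \<phi> (xB v) + \<psi> (xB v) + \<eta> (xB v) - (\<phi> xstar + \<psi> xstar + \<eta> xstar)" for v
  have gap_nonneg: "0 \<le> gap v" for v
  proof -
    have "0 = inner (uA zstar + uB zstar + C xstar) (xB v - xstar)" by (simp add: opt)
    also have "\<dots> \<le> gap v"
      using sub_f[of zstar "xB v"] sub_g[of zstar v] sub_h[of xstar "xB v"]
      by (simp add: gap_def xs xAs inner_add_left)
    finally show ?thesis .
  qed
  have gap_le: "\<gamma> * gap v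
      \<le> inner (xB v - xA v) (xB v - xstar) + \<gamma> / (2 * \<beta>f) * (norm (xB v - xA v))\<^sup>2" for v
  proof -
    \<comment> \<open>The subgradient of \<open>f\<close> is known at \<open>xA v\<close> while the
      objective is evaluated at \<open>xB v\<close>; smoothness of \<open>f\<close> transfers the
      bound at quadratic cost. With \<open>sub_f\<close> at \<open>xstar\<close>, the terms in
      \<open>uA v\<close> merge into \<open>inner (uA v) (xB v - xstar)\<close>.\<close>
    have "\<phi> (xB v) \<le> \<phi> (xA v) + inner (uA v) (xB v - xA v) + (1 / \<beta>f) / 2 * (norm (xB v - xA v))\<^sup>2"
      unfolding uA_F by (rule lipschitz_gradient_descent[OF grad_f F_lip])
    then have "gap v \<le> inner (uA v + uB v + C (xB v)) (xB v - xstar)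
        + (1 / \<beta>f) / 2 * (norm (xB v - xA v))\<^sup>2"
      using sub_f[of v xstar] sub_g[of v zstar] sub_h[of "xB v" xstar]
      by (simp add: gap_def xs inner_add_left inner_diff_right)
    then have "\<gamma> * gap v \<le> \<gamma> * (inner (uA v + uB v + C (xB v)) (xB v - xstar)
        + (1 / \<beta>f) / 2 * (norm (xB v - xA v))\<^sup>2)"
      using \<gamma> by (intro mult_left_mono) auto
    also have "\<dots> = inner (xB v - xA v) (xB v - xstar) + \<gamma> / (2 * \<beta>f) * (norm (xB v - xA v))\<^sup>2"
      unfolding distrib_left by (simp add: res)
    finally show ?thesis .
  qed

  \<comment> \<open>Averagedness of \<open>T\<close> relative to the fixed point\<close>
  have residual: "1 / (2 * \<alpha>) * (norm (v - T v))\<^sup>2 \<le> inner (v - T v) (v - zstar)" for v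
  proof -
    define p q r where "p = uA v - uA zstar" and "q = uB v - uB zstar" and "r = C (xB v) - C xstar"
    have e: "(xB v - xstar) - (xA v - xstar) = v - T v" by (simp add: T_eq)
    \<comment> \<open>Subtracting the optimality condition, which is zero, expresses the residual
      through deviations from the fixed point.\<close>
    have "v - T v = \<gamma> *\<^sub>R (uA v + uB v + C (xB v)) - \<gamma> *\<^sub>R (uA zstar + uB zstar + C xstar)"
      using res[of v] by (simp add: T_eq opt)
    then have w: "(xB v - xstar) - (xA v - xstar) = \<gamma> *\<^sub>R (p + q + r)"
      unfolding e by (simp add: p_def q_def r_def algebra_simps)
    have "0 \<le> inner p (xA v - xstar)" "0 \<le> inner q (xB v - xstar)"
      using subdifferential_monotone[OF pf uA[of v] uA[of zstar]]
        subdifferential_monotone[OF pg uB[of v] uB[of zstar]]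
      by (simp_all add: p_def q_def xs xAs)
    moreover have "\<beta> * (norm r)\<^sup>2 \<le> inner r (xB v - xstar)"
      unfolding r_def by (rule Baillon_Haddad[OF cvx_h grad_h \<beta> h_lip])
    ultimately have "(4 * \<beta> - \<gamma>) / (4 * \<beta>) * (norm (v - T v))\<^sup>2
        \<le> inner (v - T v) (xB v - xstar + \<gamma> *\<^sub>R q)"
      using splitting_residual_bound[OF \<gamma>(1) \<beta> w] unfolding e by blast
    also have "xB v - xstar + \<gamma> *\<^sub>R q = (xB v + \<gamma> *\<^sub>R uB v) - (xB zstar + \<gamma> *\<^sub>R uB zstar)"
      by (simp add: q_def xs algebra_simps)
    also have "\<dots> = v - zstar" by (simp add: xB_uB)
    finally show ?thesis by (simp only: \<alpha>_eq)
  qed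

  \<comment> \<open>Summability of the squared residuals\<close>
  define \<tau> where "\<tau> = (INF j. lam j * (1 - \<alpha> * lam j) / \<alpha>)"
  have \<tau>0: "\<tau> > 0" using tau by (simp add: \<tau>_def)
  have \<alpha>lam: "0 < lam j" "lam j < 1 / \<alpha>" "\<alpha> * lam j < 1" for j
    using lam[of j] \<alpha>0 by (auto simp: field_simps)
  have \<tau>: "\<tau> \<le> lam j * (1 - \<alpha> * lam j) / \<alpha>" for j
    unfolding \<tau>_def
  proof (rule cINF_lower)
    show "bdd_below (range (\<lambda>j. lam j * (1 - \<alpha> * lam j) / \<alpha>))"
      using \<alpha>lam \<alpha>0 by (intro bdd_belowI[of _ 0]) (auto intro!: divide_nonneg_pos mult_nonneg_nonneg less_imp_le)
  qed simp
  \<comment> \<open>Keeps the relaxation parameters away from zero, so that bounds on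
    \<open>lam k * gap (z k)\<close> become bounds on the gap itself.\<close>
  have lam_ge: "\<alpha> * \<tau> \<le> lam j" for j
  proof -
    have "\<alpha> * \<tau> \<le> lam j * (1 - \<alpha> * lam j)"
      using \<tau>[of j] \<alpha>0 by (simp add: field_simps)
    also have "\<dots> \<le> lam j * 1"
      using \<alpha>lam(1)[of j] \<alpha>0 by (intro mult_left_mono) auto
    finally show ?thesis by simp
  qed
  define N where "N k = (norm (z k - T (z k)))\<^sup>2" for k
  have N0: "0 \<le> N k" for k by (simp add: N_def)
  have step: "z k - z (Suc k) = lam k *\<^sub>R (z k - T (z k))" for k
    by (simp add: z algebra_simps)
  \<comment> \<open>Expanding the square after a relaxed step leaves a decrease of
    \<open>lam k / \<alpha> - (lam k)\<^sup>2\<close> times the squared residual, which is the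
    quantity whose infimum is \<tau>.\<close>
  have fejer: "\<tau> * N k \<le> (norm (z k - zstar))\<^sup>2 - (norm (z (Suc k) - zstar))\<^sup>2" for k
  proof -
    define w where "w = z k - T (z k)"
    have zz: "z (Suc k) - zstar = (z k - zstar) - lam k *\<^sub>R w"
      using step[of k] unfolding w_def by (simp add: algebra_simps)
    have "(norm (z (Suc k) - zstar))\<^sup>2
        = (norm (z k - zstar))\<^sup>2 - 2 * lam k * inner w (z k - zstar) + (lam k)\<^sup>2 * (norm w)\<^sup>2"
      unfolding zz power2_norm_eq_inner
      by (simp add: inner_diff_left[of "z k - zstar"] inner_diff_right[of _ "z k - zstar"]
          inner_commute power2_eq_square)
    moreover have "2 * lam k * (1 / (2 * \<alpha>) * (norm w)\<^sup>2) \<le> 2 * lam k * inner w (z k - zstar)"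
      using residual[of "z k"] \<alpha>lam(1)[of k] unfolding w_def by (intro mult_left_mono) auto
    moreover have "2 * lam k * (1 / (2 * \<alpha>) * (norm w)\<^sup>2) - (lam k)\<^sup>2 * (norm w)\<^sup>2
        = lam k * (1 - \<alpha> * lam k) / \<alpha> * (norm w)\<^sup>2"
      using \<alpha>0 by (simp add: field_simps power2_eq_square)
    moreover have "\<tau> * (norm w)\<^sup>2 \<le> lam k * (1 - \<alpha> * lam k) / \<alpha> * (norm w)\<^sup>2"
      using \<tau>[of k] by (intro mult_right_mono) auto
    ultimately show ?thesis unfolding N_def w_def[symmetric] by linarith
  qed
  have sN: "summable N"
  proof (rule summable_of_telescoping[OF N0])
    show "N k \<le> (norm (z k - zstar))\<^sup>2 / \<tau> - (norm (z (Suc k) - zstar))\<^sup>2 / \<tau> + 0" for k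
      using fejer[of k] \<tau>0 by (simp add: field_simps)
  qed (use \<tau>0 in auto)

  \<comment> \<open>Potential argument for summability of the gaps\<close>
  define V where "V k = (norm (xB (z k) - xstar))\<^sup>2 / 2
      + \<gamma> * (inner (uB (z k)) (xB (z k) - xstar) - \<psi> (xB (z k)))" for k
  \<comment> \<open>Both summands use \<open>lam k < 1 / \<alpha>\<close>: the first bounds the
    squared step from the potential, the second the smoothness error of \<open>f\<close>.\<close>
  define K where "K = (1 / \<alpha>)\<^sup>2 / 2 + 1 / \<alpha> * (\<gamma> / (2 * \<beta>f))"
  have K0: "K \<ge> 0" using \<alpha>0 \<gamma> \<beta>f by (simp add: K_def)
  have V_lower: "- \<gamma> * \<psi> xstar \<le> V k" for k
  proof -
    have "- \<psi> xstar \<le> inner (uB (z k)) (xB (z k) - xstar) - \<psi> (xB (z k))"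
      using sub_g[of "z k" zstar] by (simp add: xs inner_diff_right)
    then have "\<gamma> * (- \<psi> xstar) \<le> \<gamma> * (inner (uB (z k)) (xB (z k) - xstar) - \<psi> (xB (z k)))"
      using \<gamma> by (intro mult_left_mono) auto
    then show ?thesis unfolding V_def using zero_le_power2[of "norm (xB (z k) - xstar)"] by linarith
  qed
  \<comment> \<open>Multiplying \<open>gap_le\<close> by \<open>lam k\<close> turns the residual
    into the actual step \<open>z k - z (Suc k)\<close>, whose inner product with
    \<open>xB (z k) - xstar\<close> is controlled by the potential.\<close>
  have gap_step: "\<alpha> * \<tau> * \<gamma> * gap (z k) \<le> V k - V (Suc k) + K * N k" for k
  proof -
    have w: "xB (z k) - xA (z k) = z k - T (z k)" by (simp add: T_eq)
    have "\<alpha> * \<tau> * (\<gamma> * gap (z k)) \<le> lam k * (\<gamma> * gap (z k))"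
      using lam_ge[of k] gap_nonneg \<gamma> by (intro mult_right_mono) auto
    also have "\<dots> \<le> lam k * (inner (z k - T (z k)) (xB (z k) - xstar) + \<gamma> / (2 * \<beta>f) * N k)"
      using gap_le[of "z k"] \<alpha>lam(1)[of k] unfolding w N_def by (intro mult_left_mono) auto
    also have "\<dots> = inner (z k - z (Suc k)) (xB (z k) - xstar) + lam k * (\<gamma> / (2 * \<beta>f) * N k)"
      unfolding distrib_left by (simp add: step)
    also have "inner (z k - z (Suc k)) (xB (z k) - xstar)
        \<le> V k - V (Suc k) + (norm (z k - z (Suc k)))\<^sup>2 / 2"
      using resolvent_potential_step[OF \<gamma>(1) sub_g[of "z k" "z (Suc k)"], of "uB (z (Suc k))" xstar]
      unfolding xB_uB V_def .
    also have "(norm (z k - z (Suc k)))\<^sup>2 = (lam k)\<^sup>2 * N k"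
      unfolding step N_def by (simp add: power_mult_distrib)
    also have "(lam k)\<^sup>2 * N k / 2 \<le> (1 / \<alpha>)\<^sup>2 / 2 * N k"
      using mult_right_mono[OF power_mono[of "lam k" "1 / \<alpha>" 2] N0[of k]] \<alpha>lam[of k] by simp
    also have "lam k * (\<gamma> / (2 * \<beta>f) * N k) \<le> 1 / \<alpha> * (\<gamma> / (2 * \<beta>f) * N k)"
      using \<alpha>lam(2)[of k] \<gamma> \<beta>f N0[of k] by (intro mult_right_mono) auto
    finally show ?thesis by (simp add: K_def algebra_simps)
  qed
  define c where "c = \<alpha> * \<tau> * \<gamma>"
  have c0: "c > 0" using \<alpha>0 \<tau>0 \<gamma> by (simp add: c_def)
  have sgap: "summable (\<lambda>k. gap (z k))"
  proof (rule summable_of_telescoping)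
    \<comment> \<open>\<open>V\<close> itself may be negative; the shift by \<gamma>
      \<open>* \<psi> xstar\<close> makes it nonnegative by \<open>V_lower\<close> and cancels in
      the difference.\<close>
    show "gap (z k) \<le> (V k + \<gamma> * \<psi> xstar) / c - (V (Suc k) + \<gamma> * \<psi> xstar) / c + K / c * N k" for k
    proof -
      have "gap (z k) \<le> (V k - V (Suc k) + K * N k) / c"
        using gap_step[of k] c0 unfolding c_def[symmetric] by (simp add: pos_le_divide_eq mult.commute)
      then show ?thesis by (simp add: add_divide_distrib diff_divide_distrib)
    qed
    show "0 \<le> (V k + \<gamma> * \<psi> xstar) / c" for k
      using V_lower[of k] c0 by simp
    show "0 \<le> K / c * N k" for k using K0 c0 N0 by simp
    show "summable (\<lambda>k. K / c * N k)" by (intro summable_mult sN)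
  qed (rule gap_nonneg)

  \<comment> \<open>Running minima and the return to extended reals\<close>
  define r where "r k = Min ((\<lambda>i. gap (z i)) ` {0..k})" for k
  have gap_ereal: "(f (xg i) + g (xg i) + h (xg i)) - (f xstar + g xstar + h xstar)
      = ereal (gap (z i))" for i
  proof -
    \<comment> \<open>Finiteness of \<open>g\<close> is known only at points \<open>xB v\<close>;
      hence \<open>xstar\<close> is rewritten as \<open>xB zstar\<close> below.\<close>
    have e: "f x = ereal (\<phi> x)" "g (xB v) = ereal (\<psi> (xB v))" "h x = ereal (\<eta> x)" for x v
      using fin_f fin_g fin_h by (simp_all add: \<phi>_def \<psi>_def \<eta>_def ereal_real')
    have "xg i = xB (z i)" by (simp add: xg xB_def)
    then show ?thesis
      unfolding xs[symmetric] by (simp add: e gap_def xs[symmetric])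
  qed
  have "(MIN i\<in>{0..k}. (f (xg i) + g (xg i) + h (xg i)) - (f xstar + g xstar + h xstar))
      = ereal (r k)" for k
  proof -
    have "ereal (r k) = Min (ereal ` (\<lambda>i. gap (z i)) ` {0..k})"
      unfolding r_def by (rule mono_Min_commute) (auto simp: mono_def)
    then show ?thesis by (simp add: gap_ereal image_image)
  qed
  moreover have "0 \<le> r k" for k
    by (auto simp: r_def gap_nonneg)
  moreover have "r \<in> o(\<lambda>k. 1 / (real k + 1))"
    unfolding r_def by (rule running_Min_smallo[OF gap_nonneg sgap])
  ultimately show ?thesis by blast
qed

end
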